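(* Let $\Omega\subset\mathbb{R}^n$ be open, let $f\in C(\Omega\times\mathbb{R},\mathbb{R})$, and let $g\in C(\mathbb{R},\mathbb{R})$ be such that there exists $s_0\ge 0$ with $g\ge 0$ on $[s_0,\infty)$ and $g\le 0$ on $(-\infty,-s_0]$. Let $G(s)=\int_0^s g(\tau)\,d\tau$ and $\Phi_g(t)=\int_0^t \mathrm{e}^{G(s)}\,ds$ for $s,t\in\mathbb{R}$. Let $M:\Omega\times\mathbb{R}^n\times S_n(\mathbb{R})\to\mathbb{R}$, with associated natural gradient term $N$, satisfy the following two conditions: (i) there exists $\alpha\in\mathbb{R}$ such that $M(x,\lambda p,X)=|\lambda|^{\alpha}M(x,p,X)$ for all $\lambda\in\mathbb{R}\setminus\{0\}$ and all $(x,p,X)\in\Omega\times\mathbb{R}^n\times S_n(\mathbb{R})$; (ii) there exists $\beta\in\mathbb{N}\cup\{0\}$ such that $M(x,p,\gamma X+\sigma(p\otimes p))=\gamma^{\beta+1}M(x,p,X)+\sigma\gamma^{\beta}N(x,p,X)$ for all $\gamma\in\mathbb{R}\setminus\{0\}$, $\sigma\in\mathbb{R}$ and all $(x,p,X)\in\Omega\times\mathbb{R}^n\times S_n(\mathbb{R})$. If $u\in C^2(\Omega)$ is a solution of $$M(x,Du,D^2u)+g(u)N(x,Du,D^2u)+f(x,u)=0\quad\text{in }\Omega, \qquad (A)$$ then $v=\Phi_g(u)$ is a solution of $$M(x,Dv,D^2v)+h(x,v)=0\quad\text{in }\Omega,\qquad\text{with } h(x,s)=\mathrm{e}^{(\alpha+\beta+1)G(\Phi_g^{-1}(s))}f(x,\Phi_g^{-1}(s)).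 \qquad (B)$$ Reciprocally, if $v\in C^2(\Omega)$ solves (B), then $u=\Phi_g^{-1}(v)$ solves (A).
   Context: $S_n(\mathbb{R})$ denotes the set of real symmetric $n\times n$ matrices, and $p\otimes p$ is the matrix $[p_ip_j]$. Standing assumption: $M:\Omega\times\mathbb{R}^n\times S_n(\mathbb{R})\to\mathbb{R}$ is continuous and admits partial derivatives with respect to the entries $X_{ij}$ of $X=[X_{ij}]$. The matrix $\partial_X M(x,p,X)\in S_n(\mathbb{R})$ has $ij$ entry $\partial_X^{ij}M(x,p,X)=\frac{\partial}{\partial X_{ij}}M(x,p,X)$ if $p\ne 0$, and $\partial_X^{ij}M(x,0,X)=0$. The natural gradient term is $N(x,p,X)=\langle \partial_X M(x,p,X)p,p\rangle$ for all $(x,p,X)\in\Omega\times\mathbb{R}^n\times S_n(\mathbb{R})$. Under the assumption on $g$, $\Phi_g$ is a strictly increasing $C^2$-diffeomorphism of $\mathbb{R}$ onto $\mathbb{R}$, so $\Phi_g^{-1}:\mathbb{R}\to\mathbb{R}$ is defined. Solutions are understood in the classical pointwise sense. *)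

theory Defs
  imports "HOL-Analysis.Analysis"
begin

definition gradient :: "(real^'n \<Rightarrow> real) \<Rightarrow> real^'n \<Rightarrow> real^'n" where
  "gradient u x = (\<chi> i. frechet_derivative u (at x) (axis i 1))"

definition hessian :: "(real^'n \<Rightarrow> real) \<Rightarrow> real^'n \<Rightarrow> real^'n^'n" where
  "hessian u x = jacobian (gradient u) (at x)"

(* Only used for open \<Omega>, where the values of u outside \<Omega> are irrelevant. *)
definition C2_on :: "(real^'n) set \<Rightarrow> (real^'n \<Rightarrow> real) \<Rightarrow> bool" where
  "C2_on \<Omega> u \<longleftrightarrow>
     (\<forall>x\<in>\<Omega>. u differentiable (at x)) \<and>
     (\<forall>x\<in>\<Omega>. gradient u differentiable (at x)) \<and>
     continuous_on \<Omega> (hessian u)"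

(* Pointwise solutions in C^2(\<Omega>) of F(x, u, Du, D^2 u) = 0 in \<Omega>. *)
definition classical_solution ::
  "(real^'n) set \<Rightarrow> (real^'n \<Rightarrow> real \<Rightarrow> real^'n \<Rightarrow> real^'n^'n \<Rightarrow> real) \<Rightarrow> (real^'n \<Rightarrow> real) \<Rightarrow> bool"
where
  "classical_solution \<Omega> F u \<longleftrightarrow>
     C2_on \<Omega> u \<and> (\<forall>x\<in>\<Omega>. F x (u x) (gradient u x) (hessian u x) = 0)"

definition Sym :: "(real^'n^'n) set" where
  "Sym = {X. transpose X = X}"

definition tensor_square :: "real^'n \<Rightarrow> real^'n^'n" where
  "tensor_square p = (\<chi> i j. p $ i * p $ j)"

(* M is only given on symmetric matrices, so the partial derivative with respect to the entry
   X_ij is taken along the symmetric direction (E_ij + E_ji) / 2. With this normalization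
   [d/dX_ij M] is the gradient with respect to the Frobenius inner product (for i = j the
   direction is E_ii); it equals the matrix of ordinary entrywise partial derivatives of the
   extension X \<mapsto> M((X + X^T)/2) to all square matrices. E.g. M = <X p, p> has
   derivative p \<otimes> p. *)
definition sym_unit :: "'n \<Rightarrow> 'n \<Rightarrow> real^'n^'n" where
  "sym_unit i j =
     (\<chi> k l. ((if k = i \<and> l = j then 1 else 0) + (if k = j \<and> l = i then 1 else 0)) / 2)"

definition has_X_partials ::
  "(real^'n) set \<Rightarrow> (real^'n \<Rightarrow> real^'n \<Rightarrow> real^'n^'n \<Rightarrow> real) \<Rightarrow> bool" where
  "has_X_partials \<Omega> M \<longleftrightarrow>
     (\<forall>x\<in>\<Omega>. \<forall>p. \<forall>X\<in>Sym. \<forall>i j.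
        (\<lambda>t::real. M x p (X + t *\<^sub>R sym_unit i j)) differentiable (at 0))"

definition partial_X ::
  "(real^'n \<Rightarrow> real^'n \<Rightarrow> real^'n^'n \<Rightarrow> real) \<Rightarrow> real^'n \<Rightarrow> real^'n \<Rightarrow> real^'n^'n \<Rightarrow> real^'n^'n"
where
  "partial_X M x p X =
     (if p = 0 then 0 else (\<chi> i j. deriv (\<lambda>t::real. M x p (X + t *\<^sub>R sym_unit i j)) 0))"

definition natural_gradient_term ::
  "(real^'n \<Rightarrow> real^'n \<Rightarrow> real^'n^'n \<Rightarrow> real) \<Rightarrow> real^'n \<Rightarrow> real^'n \<Rightarrow> real^'n^'n \<Rightarrow> real"
where
  "natural_gradient_term M x p X = (partial_X M x p X *v p) \<bullet> p"

(* The interval integral is oriented, so the case of a negative upper endpoint is covered. *)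
definition G :: "(real \<Rightarrow> real) \<Rightarrow> real \<Rightarrow> real" where
  "G g s = (LBINT \<tau>=0..s. g \<tau>)"

definition Phi :: "(real \<Rightarrow> real) \<Rightarrow> real \<Rightarrow> real" where
  "Phi g t = (LBINT s=0..t. exp (G g s))"

definition transformed_f ::
  "real \<Rightarrow> nat \<Rightarrow> (real \<Rightarrow> real) \<Rightarrow> (real^'n \<Rightarrow> real \<Rightarrow> real) \<Rightarrow> real^'n \<Rightarrow> real \<Rightarrow> real"
where
  "transformed_f \<alpha> \<beta> g f x s =
     exp ((\<alpha> + real \<beta> + 1) * G g (inv (Phi g) s)) * f x (inv (Phi g) s)"

end

theory Submission
  imports Defs
begin

text \<open>
  Since \<open>Phi g\<close> has first derivative \<open>\<phi> = exp (G g)\<close> and second derivative \<open>g \<cdot> \<phi>\<close>, the function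
  \<open>v = Phi g (u)\<close> satisfies \<open>Dv = \<phi>(u) Du\<close> and \<open>D\<^sup>2v = \<phi>(u) D\<^sup>2u + g(u) \<phi>(u) (Du \<otimes> Du)\<close>. Homogeneity in
  \<open>p\<close> and the scaling law in \<open>X\<close> then give
  \<open>M(x, Dv, D\<^sup>2v) = \<phi>(u)\<^bsup>\<alpha>+\<beta>+1\<^esup> (M(x, Du, D\<^sup>2u) + g(u) N(x, Du, D\<^sup>2u))\<close>, so the two equations differ by
  a positive factor. The sign condition on \<open>g\<close> bounds \<open>\<phi>\<close> away from zero, which makes \<open>Phi g\<close> onto.
\<close>

section \<open>Symmetry of the Hessian\<close>

text \<open>
  The mean value theorem in direction \<open>h\<close> reduces the second difference to first differences of \<open>D\<close>,
  so differentiability of \<open>D\<close> at the single point \<open>x\<close> suffices.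
\<close>

lemma second_difference_estimate:
  fixes u :: "'a::euclidean_space \<Rightarrow> real"
  assumes S: "open S" "x \<in> S"
    and Du: "\<And>y. y \<in> S \<Longrightarrow> (u has_derivative (\<lambda>h. D y \<bullet> h)) (at y)"
    and DD: "(D has_derivative H) (at x)"
    and e: "e > 0"
  shows "\<exists>d>0. \<forall>t. 0 < t \<and> t < d \<longrightarrow>
    \<bar>(u (x + t *\<^sub>R h + t *\<^sub>R k) - u (x + t *\<^sub>R h) - u (x + t *\<^sub>R k) + u x) - t\<^sup>2 * (H k \<bullet> h)\<bar> \<le> e * t\<^sup>2"
proof -
  interpret H: bounded_linear H
    using DD by (rule has_derivative_bounded_linear)
  \<comment> \<open>The summand 1 keeps \<open>K\<close> positive when both directions vanish, so
    dividing by \<open>K\<close> is safe.\<close>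
  define K where "K = norm h + norm k + 1"
  have K: "K \<ge> 1" "norm h \<le> K" "norm k \<le> K" "norm h + norm k \<le> K"
    by (auto simp: K_def)
  have Kpos: "0 < K" using K(1) by linarith
  \<comment> \<open>Two linearization errors, each at most \<open>e' * t * K\<close>, are later
    paired with \<open>h\<close> at the cost of one more factor \<open>K\<close>; the total is then
    exactly \<open>e * t\<close>.\<close>
  define e' where "e' = e / (2 * K * K)"
  have e': "e' > 0" using e Kpos by (simp add: e'_def)
  obtain r where r: "r > 0" "ball x r \<subseteq> S"
    using S openE by blast
  obtain d0 where d0: "d0 > 0"
    "\<And>y. norm (y - x) < d0 \<Longrightarrow> norm (D y - D x - H (y - x)) \<le> e' * norm (y - x)"
    using DD e' unfolding has_derivative_at_alt by blast
  define d where "d = min r d0 / K"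
  have d: "d > 0" using r d0 Kpos by (simp add: d_def)
  have "\<bar>(u (x + t *\<^sub>R h + t *\<^sub>R k) - u (x + t *\<^sub>R h) - u (x + t *\<^sub>R k) + u x) - t\<^sup>2 * (H k \<bullet> h)\<bar> \<le> e * t\<^sup>2"
    if t: "0 < t" "t < d" for t
  proof -
    have tK: "t * K < r" "t * K < d0"
      using t Kpos by (simp_all add: d_def field_simps)
    have small: "norm (s *\<^sub>R h + c *\<^sub>R k) \<le> t * K" if "0 \<le> s" "s \<le> t" "0 \<le> c" "c \<le> t" for s c
    proof -
      have "norm (s *\<^sub>R h + c *\<^sub>R k) \<le> s * norm h + c * norm k"
        using norm_triangle_ineq[of "s *\<^sub>R h" "c *\<^sub>R k"] that by simp
      also have "\<dots> \<le> t * norm h + t * norm k"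
        using that by (intro add_mono mult_right_mono) auto
      also have "\<dots> = t * (norm h + norm k)" by (simp add: algebra_simps)
      also have "\<dots> \<le> t * K"
        using K t by (intro mult_left_mono) auto
      finally show ?thesis .
    qed
    have inS: "x + (s *\<^sub>R h + c *\<^sub>R k) \<in> S" if "0 \<le> s" "s \<le> t" "0 \<le> c" "c \<le> t" for s c
      by (rule subsetD[OF r(2)]) (use small[OF that] tK in \<open>simp add: dist_norm norm_minus_commute add.commute\<close>)
    have D_err: "norm (D (x + w) - D x - H w) \<le> e' * (t * K)" if "norm w \<le> t * K" for w
    proof -
      have "norm (D (x + w) - D x - H w) \<le> e' * norm w"
        using d0(2)[of "x + w"] that tK by simp
      also have "\<dots> \<le> e' * (t * K)"
        using that e' by (intro mult_left_mono) auto
      finally show ?thesis .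
    qed
    \<comment> \<open>First difference in direction \<open>k\<close>, viewed along \<open>h\<close>;
      its increment over \<open>[0, t]\<close> is the second difference. The term
      \<open>0 *\<^sub>R k\<close> gives both summands one shape, so \<open>der\<close> covers them
      with c = t and c = 0.\<close>
    define \<phi> where "\<phi> s = u (x + (s *\<^sub>R h + t *\<^sub>R k)) - u (x + (s *\<^sub>R h + 0 *\<^sub>R k))" for s
    have der: "((\<lambda>s. u (x + (s *\<^sub>R h + c *\<^sub>R k))) has_derivative
        (\<lambda>z. D (x + (s *\<^sub>R h + c *\<^sub>R k)) \<bullet> (z *\<^sub>R h))) (at s within {0..t})"
      if "0 \<le> s" "s \<le> t" "0 \<le> c" "c \<le> t" for s c
    proof (rule has_derivative_compose[where g = u])
      show "(u has_derivative (\<lambda>w. D (x + (s *\<^sub>R h + c *\<^sub>R k)) \<bullet> w)) (at (x + (s *\<^sub>R h + c *\<^sub>R k)))"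
        by (rule Du[OF inS[OF that]])
      show "((\<lambda>s. x + (s *\<^sub>R h + c *\<^sub>R k)) has_derivative (\<lambda>z. z *\<^sub>R h)) (at s within {0..t})"
        by (auto intro!: derivative_eq_intros)
    qed
    have "\<exists>s\<in>{0..t}. \<phi> t - \<phi> 0 =
        D (x + (s *\<^sub>R h + t *\<^sub>R k)) \<bullet> ((t - 0) *\<^sub>R h) - D (x + (s *\<^sub>R h + 0 *\<^sub>R k)) \<bullet> ((t - 0) *\<^sub>R h)"
      unfolding \<phi>_def
      by (rule mvt_very_simple, use t in simp, intro has_derivative_diff der) (use t in auto)
    then obtain s where s: "0 \<le> s" "s \<le> t"
      and eq: "\<phi> t - \<phi> 0 = t * ((D (x + (s *\<^sub>R h + t *\<^sub>R k)) - D (x + (s *\<^sub>R h + 0 *\<^sub>R k))) \<bullet> h)"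
      by (auto simp: inner_diff_left algebra_simps)
    \<comment> \<open>Subtracting the two expansions of \<open>D\<close> at \<open>x\<close> cancels
      \<open>D x\<close> and the part \<open>H (s *\<^sub>R h)\<close>, so the difference of
      \<open>D\<close> is \<open>E\<close> plus the main term
      \<open>t *\<^sub>R H k\<close>.\<close>
    define E where "E = (D (x + (s *\<^sub>R h + t *\<^sub>R k)) - D x - H (s *\<^sub>R h + t *\<^sub>R k))
        - (D (x + (s *\<^sub>R h + 0 *\<^sub>R k)) - D x - H (s *\<^sub>R h + 0 *\<^sub>R k))"
    have "norm E \<le> e' * (t * K) + e' * (t * K)"
      unfolding E_def
      by (rule order_trans[OF norm_triangle_ineq4 add_mono]) (intro D_err small; use s t in simp)+
    then have "\<bar>E \<bullet> h\<bar> \<le> (e' * (t * K) + e' * (t * K)) * K"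
      by (intro order_trans[OF Cauchy_Schwarz_ineq2] mult_mono) (use K t e' in auto)
    also have "\<dots> = e * t"
      using Kpos by (simp add: e'_def field_simps)
    finally have E: "\<bar>E \<bullet> h\<bar> \<le> e * t" .
    have "D (x + (s *\<^sub>R h + t *\<^sub>R k)) - D (x + (s *\<^sub>R h + 0 *\<^sub>R k)) = E + t *\<^sub>R H k"
      by (simp add: E_def H.add H.scaleR)
    then have "\<phi> t - \<phi> 0 - t\<^sup>2 * (H k \<bullet> h) = t * (E \<bullet> h)"
      by (simp add: eq inner_add_left power2_eq_square algebra_simps)
    then have "\<bar>\<phi> t - \<phi> 0 - t\<^sup>2 * (H k \<bullet> h)\<bar> \<le> t * (e * t)"
      using E t by (simp add: abs_mult mult_left_mono)
    moreover have "\<phi> t - \<phi> 0 = u (x + t *\<^sub>R h + t *\<^sub>R k) - u (x + t *\<^sub>R h) - u (x + t *\<^sub>R k) + u x"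
      by (simp add: \<phi>_def add.assoc)
    ultimately show ?thesis
      by (simp add: power2_eq_square mult_ac)
  qed
  with d show ?thesis by blast
qed

text \<open>The second difference does not change when \<open>h\<close> and \<open>k\<close> are
  swapped, so its quotient by \<open>t\<^sup>2\<close> tends to both sides of the equation.\<close>

lemma second_derivative_symmetric:
  fixes u :: "'a::euclidean_space \<Rightarrow> real"
  assumes S: "open S" "x \<in> S"
    and Du: "\<And>y. y \<in> S \<Longrightarrow> (u has_derivative (\<lambda>h. D y \<bullet> h)) (at y)"
    and DD: "(D has_derivative H) (at x)"
  shows "H k \<bullet> h = H h \<bullet> k"
proof (rule ccontr)
  assume ne: "H k \<bullet> h \<noteq> H h \<bullet> k"
  \<comment> \<open>With a third of the gap, the two estimates bound
    \<open>3 * e * t\<^sup>2\<close> by \<open>2 * e * t\<^sup>2\<close>, a contradiction.\<close>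
  define e where "e = \<bar>H k \<bullet> h - H h \<bullet> k\<bar> / 3"
  have e: "e > 0" using ne by (simp add: e_def)
  obtain d1 where d1: "d1 > 0" "\<And>t. 0 < t \<Longrightarrow> t < d1 \<Longrightarrow>
    \<bar>(u (x + t *\<^sub>R h + t *\<^sub>R k) - u (x + t *\<^sub>R h) - u (x + t *\<^sub>R k) + u x) - t\<^sup>2 * (H k \<bullet> h)\<bar> \<le> e * t\<^sup>2"
    using second_difference_estimate[OF S Du DD e, of h k] by blast
  obtain d2 where d2: "d2 > 0" "\<And>t. 0 < t \<Longrightarrow> t < d2 \<Longrightarrow>
    \<bar>(u (x + t *\<^sub>R k + t *\<^sub>R h) - u (x + t *\<^sub>R k) - u (x + t *\<^sub>R h) + u x) - t\<^sup>2 * (H h \<bullet> k)\<bar> \<le> e * t\<^sup>2"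
    using second_difference_estimate[OF S Du DD e, of k h] by blast
  define t where "t = min d1 d2 / 2"
  have t: "0 < t" "t < d1" "t < d2" using d1(1) d2(1) by (auto simp: t_def)
  have "x + t *\<^sub>R k + t *\<^sub>R h = x + t *\<^sub>R h + t *\<^sub>R k" by simp
  then have "\<bar>t\<^sup>2 * (H k \<bullet> h) - t\<^sup>2 * (H h \<bullet> k)\<bar> \<le> 2 * (e * t\<^sup>2)"
    using d1(2)[OF t(1,2)] d2(2)[OF t(1,3)] by (smt (verit))
  moreover have "\<bar>t\<^sup>2 * (H k \<bullet> h) - t\<^sup>2 * (H h \<bullet> k)\<bar> = t\<^sup>2 * (3 * e)"
    by (simp add: e_def abs_mult flip: right_diff_distrib)
  ultimately have "t\<^sup>2 * e \<le> 0" by (simp add: algebra_simps)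
  then show False using t(1) e by (simp add: mult_le_0_iff)
qed

section \<open>Gradients and Hessians as representations of derivatives\<close>

lemma has_derivative_gradient:
  assumes "u differentiable (at x)"
  shows "(u has_derivative (\<lambda>h. gradient u x \<bullet> h)) (at x)"
proof -
  have d: "(u has_derivative frechet_derivative u (at x)) (at x)"
    using assms by (simp add: frechet_derivative_works)
  interpret bounded_linear "frechet_derivative u (at x)"
    using d by (rule has_derivative_bounded_linear)
  have "frechet_derivative u (at x) h = gradient u x \<bullet> h" for h
  proof -
    have "frechet_derivative u (at x) h = frechet_derivative u (at x) (\<Sum>i\<in>UNIV. h $ i *\<^sub>R axis i 1)"
      using basis_expansion[of h] by (simp add: scalar_mult_eq_scaleR)
    also have "\<dots> = gradient u x \<bullet> h"
      by (simp add: sum scaleR gradient_def inner_vec_def mult.commute)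
    finally show ?thesis .
  qed
  then have "frechet_derivative u (at x) = (\<lambda>h. gradient u x \<bullet> h)" by blast
  with d show ?thesis by simp
qed

lemma gradient_unique:
  assumes "(u has_derivative (\<lambda>h. p \<bullet> h)) (at x)"
  shows "gradient u x = p"
  using frechet_derivative_at[OF assms, symmetric]
  by (simp add: gradient_def inner_axis vec_eq_iff)

lemma hessian_unique:
  assumes "(gradient u has_derivative (\<lambda>h. A *v h)) (at x)"
  shows "hessian u x = A"
  using frechet_derivative_at[OF assms, symmetric]
  by (simp add: hessian_def jacobian_def)

text \<open>Needed because both structural conditions on \<open>M\<close> are assumed for symmetric
  matrices only.\<close>

lemma hessian_Sym:
  assumes S: "open S" "x \<in> S" and u: "C2_on S u"
  shows "hessian u x \<in> Sym"
proof -
  have D: "(u has_derivative (\<lambda>h. gradient u y \<bullet> h)) (at y)" if "y \<in> S" for y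
    using u that by (simp add: C2_on_def has_derivative_gradient)
  have DD: "(gradient u has_derivative (\<lambda>h. hessian u x *v h)) (at x)"
    using u S by (simp add: C2_on_def hessian_def jacobian_works)
  have "(hessian u x *v axis j 1) \<bullet> axis i 1 = (hessian u x *v axis i 1) \<bullet> axis j 1" for i j
    by (rule second_derivative_symmetric[OF S D DD])
  then show ?thesis
    by (simp add: Sym_def transpose_def vec_eq_iff inner_axis matrix_vector_mult_basis column_def)
qed

section \<open>Left composition with scalar functions\<close>

lemma has_derivative_compose_real:
  fixes u :: "real^'n \<Rightarrow> real"
  assumes "u differentiable (at x)" and "(F has_real_derivative c) (at (u x))"
  shows "((\<lambda>x. F (u x)) has_derivative (\<lambda>h. (c *\<^sub>R gradient u x) \<bullet> h)) (at x)"
proof -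
  have "((\<lambda>x. F (u x)) has_derivative (\<lambda>h. c * (gradient u x \<bullet> h))) (at x)"
    using has_derivative_compose[OF has_derivative_gradient[OF assms(1)]
        assms(2)[unfolded has_field_derivative_def]] .
  then show ?thesis by simp
qed

text \<open>Chain rule for the gradient, then product rule: differentiating the coefficient
  \<open>F' (u x)\<close> produces the rank-one term. \<open>F\<close> is kept general so as to
  serve both \<open>Phi g\<close> and its inverse.\<close>

lemma C2_on_compose:
  fixes u :: "real^'n \<Rightarrow> real"
  assumes S: "open S" and u: "C2_on S u"
    and F1: "\<And>t. (F has_real_derivative F' t) (at t)"
    and F2: "\<And>t. (F' has_real_derivative F'' t) (at t)"
    and cont: "continuous_on UNIV F''"
  shows "C2_on S (\<lambda>x. F (u x))"
    and "x \<in> S \<Longrightarrow> gradient (\<lambda>x. F (u x)) x = F' (u x) *\<^sub>R gradient u x"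
    and "x \<in> S \<Longrightarrow> hessian (\<lambda>x. F (u x)) x =
           F' (u x) *\<^sub>R hessian u x + F'' (u x) *\<^sub>R tensor_square (gradient u x)"
proof -
  have ud: "u differentiable (at x)" if "x \<in> S" for x
    using u that by (simp add: C2_on_def)
  have DF: "((\<lambda>x. F (u x)) has_derivative (\<lambda>h. (F' (u x) *\<^sub>R gradient u x) \<bullet> h)) (at x)"
    if "x \<in> S" for x
    using has_derivative_compose_real[OF ud[OF that] F1] .
  show grad: "gradient (\<lambda>x. F (u x)) x = F' (u x) *\<^sub>R gradient u x" if "x \<in> S" for x
    using gradient_unique[OF DF[OF that]] .
  let ?A = "\<lambda>x. F' (u x) *\<^sub>R hessian u x + F'' (u x) *\<^sub>R tensor_square (gradient u x)"
  have DD: "(gradient (\<lambda>x. F (u x)) has_derivative (\<lambda>h. ?A x *v h)) (at x)" if x: "x \<in> S" for x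
  proof -
    have Dg: "(gradient u has_derivative (\<lambda>h. hessian u x *v h)) (at x)"
      using u x by (simp add: C2_on_def hessian_def jacobian_works)
    \<comment> \<open>Puts the rank-one matrix in the form that the product rule delivers.\<close>
    have "tensor_square (gradient u x) *v h = (gradient u x \<bullet> h) *\<^sub>R gradient u x" for h
      by (simp add: tensor_square_def matrix_vector_mult_def vec_eq_iff inner_vec_def
          sum_distrib_left mult_ac)
    then have "((\<lambda>x. F' (u x) *\<^sub>R gradient u x) has_derivative (\<lambda>h. ?A x *v h)) (at x)"
      by (intro has_derivative_eq_rhs[OF has_derivative_scaleR[OF has_derivative_compose_real[OF ud[OF x] F2] Dg]])
        (simp add: fun_eq_iff matrix_vector_mult_add_rdistrib scaleR_matrix_vector_assoc[symmetric])
    then show ?thesis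
      by (rule has_derivative_transform_within_open[OF _ S x]) (simp add: grad)
  qed
  show hess: "hessian (\<lambda>x. F (u x)) x = ?A x" if "x \<in> S" for x
    using hessian_unique[OF DD[OF that]] .
  have cu: "continuous_on S u" and cg: "continuous_on S (gradient u)"
    using u by (auto simp: C2_on_def intro!: differentiable_imp_continuous_on
        intro: differentiable_at_imp_differentiable_on)
  have cF': "continuous_on UNIV F'"
    using F2 by (meson DERIV_continuous_on has_field_derivative_at_within)
  have "continuous_on S ?A"
    unfolding tensor_square_def
    using u by (intro continuous_intros continuous_on_compose2[OF cF' cu]
        continuous_on_compose2[OF cont cu] continuous_on_vec_lambda cg) (auto simp: C2_on_def)
  then have "continuous_on S (hessian (\<lambda>x. F (u x)))"
    by (rule continuous_on_eq) (simp add: hess)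
  then show "C2_on S (\<lambda>x. F (u x))"
    using DF DD by (auto simp: C2_on_def differentiable_def)
qed

section \<open>The change of variable\<close>

lemma has_real_derivative_LBINT:
  fixes g :: "real \<Rightarrow> real"
  assumes "continuous_on UNIV g"
  shows "((\<lambda>s. LBINT y=0..s. g y) has_real_derivative g t) (at t)"
proof -
  \<comment> \<open>An interval containing 0 and having \<open>t\<close> in its interior, so that
    the derivative within it is the full derivative, for negative \<open>t\<close> as well.\<close>
  define a where "a = - \<bar>t\<bar> - 1"
  define b where "b = \<bar>t\<bar> + 1"
  have ab: "a \<le> 0" "0 \<le> b" "a < t" "t < b" by (auto simp: a_def b_def)
  have "((\<lambda>s. LBINT y=ereal 0..s. g y) has_vector_derivative g t) (at t within {a..b})"
    using ab assms by (intro interval_integral_FTC2) (auto intro: continuous_on_subset)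
  moreover have "at t within {a..b} = at t"
    using ab by (intro at_within_Icc_at) auto
  ultimately show ?thesis
    by (simp add: has_real_derivative_iff_has_vector_derivative zero_ereal_def)
qed

context
  fixes g :: "real \<Rightarrow> real"
  assumes cont_g: "continuous_on UNIV g"
begin

lemma G_deriv: "(G g has_real_derivative g t) (at t)"
  using has_real_derivative_LBINT[OF cont_g] by (simp add: G_def[abs_def])

lemma exp_G_deriv: "((\<lambda>t. exp (G g t)) has_real_derivative g t * exp (G g t)) (at t)"
  by (auto intro!: derivative_eq_intros G_deriv)

lemma G_continuous: "continuous_on A (G g)"
  using G_deriv by (meson DERIV_continuous_on has_field_derivative_at_within)

lemma Phi_deriv: "(Phi g has_real_derivative exp (G g t)) (at t)"
  using has_real_derivative_LBINT[of "\<lambda>s. exp (G g s)"]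
  by (simp add: Phi_def[abs_def] continuous_on_exp G_continuous)

lemma Phi_strict_mono: "strict_mono (Phi g)"
proof (rule strict_monoI)
  show "Phi g s < Phi g t" if "s < t" for s t
    by (rule DERIV_pos_imp_increasing[OF that]) (use Phi_deriv exp_gt_zero in blast)
qed

section \<open>Bijectivity of \<open>Phi g\<close> and regularity of its inverse\<close>

context
  assumes sign_g: "\<exists>s0\<ge>0. (\<forall>s\<ge>s0. g s \<ge> 0) \<and> (\<forall>s\<le>-s0. g s \<le> 0)"
begin

text \<open>On the compact interval from -s0 to s0 a minimum is attained; since G' = g, the sign
  condition makes \<open>G g\<close> nonincreasing to the left of it and nondecreasing to the right,
  so this minimum is global.\<close>

lemma G_bounded_below: "\<exists>m. \<forall>t. m \<le> G g t"
proof -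
  obtain s0 where s0: "s0 \<ge> 0" "\<And>s. s \<ge> s0 \<Longrightarrow> g s \<ge> 0" "\<And>s. s \<le> - s0 \<Longrightarrow> g s \<le> 0"
    using sign_g by blast
  have "\<exists>x\<in>{-s0..s0}. \<forall>y\<in>{-s0..s0}. G g x \<le> G g y"
    using s0(1) by (intro continuous_attains_inf G_continuous) auto
  then obtain x where x: "\<And>y. -s0 \<le> y \<Longrightarrow> y \<le> s0 \<Longrightarrow> G g x \<le> G g y"
    by (metis atLeastAtMost_iff)
  have "G g x \<le> G g t" for t
  proof -
    consider "t \<le> - s0" | "-s0 \<le> t" "t \<le> s0" | "s0 \<le> t" by linarith
    then show ?thesis
    proof cases
      case 1
      have "G g (-s0) \<le> G g t"
        by (rule DERIV_nonpos_imp_nonincreasing[OF 1]) (use G_deriv s0(3) in blast)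
      with x[of "-s0"] s0(1) show ?thesis by simp
    next
      case 3
      have "G g s0 \<le> G g t"
        by (rule DERIV_nonneg_imp_nondecreasing[OF 3]) (use G_deriv s0(2) in blast)
      with x[of s0] s0(1) show ?thesis by simp
    qed (rule x)
  qed
  then show ?thesis by blast
qed

text \<open>The derivative of \<open>Phi g\<close> is at least \<open>exp m\<close>, so
  \<open>Phi g\<close> grows at least linearly in both directions and the intermediate value theorem
  reaches every level.\<close>

lemma Phi_bij: "bij (Phi g)"
proof -
  obtain m where m: "\<And>t. m \<le> G g t" using G_bounded_below by blast
  have d: "((\<lambda>t. Phi g t - exp m * t) has_real_derivative exp (G g t) - exp m) (at t)" for t
    by (auto intro!: derivative_eq_intros Phi_deriv)
  have mono: "Phi g s - exp m * s \<le> Phi g t - exp m * t" if "s \<le> t" for s t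
    by (rule DERIV_nonneg_imp_nondecreasing[OF that]) (use d m in force)
  have "y \<in> range (Phi g)" for y
  proof -
    have Phi0: "Phi g 0 = 0" by (simp add: Phi_def flip: zero_ereal_def)
    \<comment> \<open>Chosen so that the linear bound gives \<open>Phi g b\<close> \<ge> |y| and
      \<open>Phi g (-b)\<close> \<le> -|y|.\<close>
    define b where "b = \<bar>y\<bar> / exp m"
    have b: "b \<ge> 0" "exp m * b = \<bar>y\<bar>" by (auto simp: b_def)
    have "Phi g (-b) \<le> y" "y \<le> Phi g b"
      using mono[of 0 b] mono[of "-b" 0] b Phi0 by auto
    moreover have "continuous_on {-b..b} (Phi g)"
      using Phi_deriv by (meson DERIV_continuous_on has_field_derivative_at_within)
    ultimately show ?thesis
      using IVT'[of "Phi g" "-b" y b] b by auto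
  qed
  then show ?thesis
    using Phi_strict_mono by (auto simp: bij_def strict_mono_imp_inj_on)
qed

lemma Phi_inv [simp]: "Phi g (inv (Phi g) y) = y" "inv (Phi g) (Phi g t) = t"
  using Phi_bij by (simp_all add: bij_is_surj surj_f_inv_f bij_is_inj)

lemma inv_Phi_deriv:
  "(inv (Phi g) has_real_derivative exp (- G g (inv (Phi g) y))) (at y)"
proof -
  have "isCont (inv (Phi g)) (Phi g (inv (Phi g) y))"
    by (rule isCont_inverse_function[of 1]) (auto intro: DERIV_isCont[OF Phi_deriv])
  then have "(inv (Phi g) has_real_derivative inverse (exp (G g (inv (Phi g) y)))) (at y)"
    \<comment> \<open>The inverse is global, so any open interval around \<open>y\<close> would
      do.\<close>
    by (intro DERIV_inverse_function[OF Phi_deriv, of _ _ "y - 1" "y + 1"]) auto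
  then show ?thesis by (simp add: exp_minus)
qed

text \<open>One factor of the square comes from the exponential, the other from the derivative of
  the inverse inside it.\<close>

lemma inv_Phi_deriv2:
  "((\<lambda>y. exp (- G g (inv (Phi g) y))) has_real_derivative
     - g (inv (Phi g) y) * (exp (- G g (inv (Phi g) y)))\<^sup>2) (at y)"
  by (rule derivative_eq_intros DERIV_chain2[OF G_deriv inv_Phi_deriv] refl)+
    (simp add: power2_eq_square)

text \<open>Supplies the regularity of u in the reciprocal direction, where only v is known to be of
  class C^2.\<close>

lemma C2_on_inv_Phi:
  assumes "open S" "C2_on S v"
  shows "C2_on S (\<lambda>x. inv (Phi g) (v x))"
proof (rule C2_on_compose(1)[OF assms inv_Phi_deriv inv_Phi_deriv2])
  have c: "continuous_on UNIV (inv (Phi g))"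
    using inv_Phi_deriv by (meson DERIV_continuous_on has_field_derivative_at_within)
  show "continuous_on UNIV (\<lambda>y. - g (inv (Phi g) y) * (exp (- G g (inv (Phi g) y)))\<^sup>2)"
    by (intro continuous_intros continuous_on_compose2[OF cont_g c]
        continuous_on_compose2[OF G_continuous c]) auto
qed

end

lemma C2_on_Phi:
  fixes u :: "real^'n \<Rightarrow> real"
  assumes "open S" "C2_on S u"
  shows "C2_on S (\<lambda>x. Phi g (u x))"
    and "x \<in> S \<Longrightarrow> gradient (\<lambda>x. Phi g (u x)) x = exp (G g (u x)) *\<^sub>R gradient u x"
    and "x \<in> S \<Longrightarrow> hessian (\<lambda>x. Phi g (u x)) x = exp (G g (u x)) *\<^sub>R hessian u x
           + (g (u x) * exp (G g (u x))) *\<^sub>R tensor_square (gradient u x)"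
proof -
  have c: "continuous_on UNIV (\<lambda>t. g t * exp (G g t))"
    by (intro continuous_intros cont_g G_continuous)
  note * = C2_on_compose[OF assms Phi_deriv exp_G_deriv c]
  show "C2_on S (\<lambda>x. Phi g (u x))" by (rule *(1))
  show "x \<in> S \<Longrightarrow> gradient (\<lambda>x. Phi g (u x)) x = exp (G g (u x)) *\<^sub>R gradient u x" by (rule *(2))
  show "x \<in> S \<Longrightarrow> hessian (\<lambda>x. Phi g (u x)) x = exp (G g (u x)) *\<^sub>R hessian u x
           + (g (u x) * exp (G g (u x))) *\<^sub>R tensor_square (gradient u x)" by (rule *(3))
qed

end

section \<open>The operator after substitution, and the equivalence of the two equations\<close>

lemma operator_Phi:
  fixes M :: "real^'n \<Rightarrow> real^'n \<Rightarrow> real^'n^'n \<Rightarrow> real"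
  assumes S: "open S" "x \<in> S" and g: "continuous_on UNIV g" and u: "C2_on S u"
    and hom: "\<And>p X (c::real). X \<in> Sym \<Longrightarrow> c \<noteq> 0 \<Longrightarrow> M x (c *\<^sub>R p) X = \<bar>c\<bar> powr \<alpha> * M x p X"
    and scale: "\<And>p X (\<gamma>::real) (\<sigma>::real). X \<in> Sym \<Longrightarrow> \<gamma> \<noteq> 0 \<Longrightarrow>
           M x p (\<gamma> *\<^sub>R X + \<sigma> *\<^sub>R tensor_square p) =
             \<gamma> ^ (\<beta> + 1) * M x p X + \<sigma> * \<gamma> ^ \<beta> * natural_gradient_term M x p X"
  shows "M x (gradient (\<lambda>x. Phi g (u x)) x) (hessian (\<lambda>x. Phi g (u x)) x) =
    exp ((\<alpha> + real \<beta> + 1) * G g (u x)) *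
      (M x (gradient u x) (hessian u x)
        + g (u x) * natural_gradient_term M x (gradient u x) (hessian u x))"
proof -
  let ?c = "exp (G g (u x))"
  let ?p = "gradient u x" and ?X = "hessian u x"
  have X: "?X \<in> Sym" using hessian_Sym[OF S u] .
  \<comment> \<open>Homogeneity is applied with the new Hessian in the matrix slot, so that matrix
    must be symmetric too.\<close>
  have Y: "hessian (\<lambda>x. Phi g (u x)) x \<in> Sym"
    using hessian_Sym[OF S C2_on_Phi(1)[OF g S(1) u]] .
  \<comment> \<open>The power \<alpha> comes from scaling the gradient, the power \<beta> + 1 from
    scaling the Hessian.\<close>
  have c: "exp ((\<alpha> + real \<beta> + 1) * G g (u x)) = ?c powr \<alpha> * ?c ^ (\<beta> + 1)"
    by (simp add: powr_def exp_of_nat_mult[symmetric] exp_add[symmetric] algebra_simps del: power_Suc)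
  \<comment> \<open>The gradient slot is rescaled first: the scaling law then applies with p = Du,
    matching the tensor square in the Hessian, and with \<gamma> = e^G(u) and \<sigma> = g(u)
    e^G(u).\<close>
  have "M x (gradient (\<lambda>x. Phi g (u x)) x) (hessian (\<lambda>x. Phi g (u x)) x) =
      ?c powr \<alpha> * M x ?p (?c *\<^sub>R ?X + (g (u x) * ?c) *\<^sub>R tensor_square ?p)"
    using hom[OF Y, of ?c ?p] C2_on_Phi(2,3)[OF g S(1) u S(2)] by simp
  also have "\<dots> = ?c powr \<alpha> * (?c ^ (\<beta> + 1) * M x ?p ?X
      + (g (u x) * ?c) * ?c ^ \<beta> * natural_gradient_term M x ?p ?X)"
    using scale[OF X, of ?c ?p "g (u x) * ?c"] by simp
  also have "\<dots> = exp ((\<alpha> + real \<beta> + 1) * G g (u x)) *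
      (M x ?p ?X + g (u x) * natural_gradient_term M x ?p ?X)"
    unfolding c by (simp add: algebra_simps)
  finally show ?thesis .
qed

theorem theorem1:
  fixes \<Omega> :: "(real^'n) set"
    and f :: "real^'n \<Rightarrow> real \<Rightarrow> real"
    and g :: "real \<Rightarrow> real"
    and M :: "real^'n \<Rightarrow> real^'n \<Rightarrow> real^'n^'n \<Rightarrow> real"
    and \<alpha> :: real and \<beta> :: nat
  assumes "open \<Omega>"
    and "continuous_on (\<Omega> \<times> UNIV) (\<lambda>(x, s). f x s)"
    and "continuous_on UNIV g"
    and "\<exists>s0\<ge>0. (\<forall>s\<ge>s0. g s \<ge> 0) \<and> (\<forall>s\<le>-s0. g s \<le> 0)"
    and "continuous_on (\<Omega> \<times> UNIV \<times> Sym) (\<lambda>(x, p, X). M x p X)"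
    and "has_X_partials \<Omega> M"
    and "\<And>x p X (c::real). x \<in> \<Omega> \<Longrightarrow> X \<in> Sym \<Longrightarrow> c \<noteq> 0 \<Longrightarrow>
           M x (c *\<^sub>R p) X = \<bar>c\<bar> powr \<alpha> * M x p X"
    and "\<And>x p X (\<gamma>::real) (\<sigma>::real). x \<in> \<Omega> \<Longrightarrow> X \<in> Sym \<Longrightarrow> \<gamma> \<noteq> 0 \<Longrightarrow>
           M x p (\<gamma> *\<^sub>R X + \<sigma> *\<^sub>R tensor_square p) =
             \<gamma> ^ (\<beta> + 1) * M x p X + \<sigma> * \<gamma> ^ \<beta> * natural_gradient_term M x p X"
  shows "(\<forall>u. classical_solution \<Omega>
                (\<lambda>x s p X. M x p X + g s * natural_gradient_term M x p X + f x s) u \<longrightarrow>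
              classical_solution \<Omega>
                (\<lambda>x s p X. M x p X + transformed_f \<alpha> \<beta> g f x s) (\<lambda>x. Phi g (u x))) \<and>
         (\<forall>v. classical_solution \<Omega>
                (\<lambda>x s p X. M x p X + transformed_f \<alpha> \<beta> g f x s) v \<longrightarrow>
              classical_solution \<Omega>
                (\<lambda>x s p X. M x p X + g s * natural_gradient_term M x p X + f x s)
                (\<lambda>x. inv (Phi g) (v x)))"
proof -
  note S = assms(1) and g = assms(3) and sign = assms(4)
  have op: "M x (gradient (\<lambda>x. Phi g (u x)) x) (hessian (\<lambda>x. Phi g (u x)) x) =
    exp ((\<alpha> + real \<beta> + 1) * G g (u x)) *
      (M x (gradient u x) (hessian u x)
        + g (u x) * natural_gradient_term M x (gradient u x) (hessian u x))"
    if "C2_on \<Omega> u" "x \<in> \<Omega>" for u x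
    using operator_Phi[where M = M, OF S that(2) g that(1) assms(7)[OF that(2)] assms(8)[OF that(2)]] .
  \<comment> \<open>At \<open>Phi g (u x)\<close> the inverse in \<open>transformed_f\<close>
    cancels, so both terms of the transformed equation carry the same nonzero exponential factor.
    Dividing it out is reversible, which serves both directions.\<close>
  have iff: "classical_solution \<Omega>
        (\<lambda>x s p X. M x p X + transformed_f \<alpha> \<beta> g f x s) (\<lambda>x. Phi g (u x)) \<longleftrightarrow>
      classical_solution \<Omega>
        (\<lambda>x s p X. M x p X + g s * natural_gradient_term M x p X + f x s) u"
    if u: "C2_on \<Omega> u" for u
    using C2_on_Phi(1)[OF g S u] u
    by (auto simp: classical_solution_def transformed_f_def op[OF u] Phi_inv[OF g sign]
        simp flip: distrib_left)
  have "classical_solution \<Omega>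
      (\<lambda>x s p X. M x p X + g s * natural_gradient_term M x p X + f x s) (\<lambda>x. inv (Phi g) (v x))"
    if v: "classical_solution \<Omega> (\<lambda>x s p X. M x p X + transformed_f \<alpha> \<beta> g f x s) v" for v
    \<comment> \<open>Taken at u = \<open>inv (Phi g)\<close> of v, for which \<open>Phi g\<close>
      of u is v again.\<close>
    using iff[OF C2_on_inv_Phi[OF g sign S, of v]] v
    by (simp add: Phi_inv[OF g sign] classical_solution_def)
  then show ?thesis
    using iff by (auto simp: classical_solution_def)
qed

end
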